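(* Let $-3<\gamma\le1$ and $\alpha\in(\nu,1)$, where $\nu$ is the angular singularity exponent of the kernel $B$. For fixed $v_*\in\mathbb{R}^3$ let $$\mathcal T\varphi(v)=\int_{\mathbb{S}^2}B(v-v_*,\sigma)\,(\varphi(v')-\varphi(v))\,d\sigma .$$ Then there are constants $C_{\nu,\alpha},C'_{\nu,\alpha}>0$ such that for all $\varphi\in C^\alpha_c(\mathbb{R}^3_v)$, $$|\mathcal T\varphi(v)|\le C_{\nu,\alpha}\|\varphi\|_{C^\alpha_c}|v-v_*|^{\alpha+\gamma}\le C'_{\nu,\alpha}\|\varphi\|_{C^\alpha_c}|v-v_*|^{\alpha}M(|v-v_*|).$$
   Context: $v'=\frac{v+v_*}{2}+\frac{|v-v_*|}{2}\sigma$, $\sigma\in\mathbb{S}^2$. Kernel: $B(z,\sigma)=|z|^\gamma b(k\cdot\sigma)$, $k=z/|z|$, $k\cdot\sigma=\cos\theta$, $b\ge0$ supported in $0\le\theta\le\pi/2$, $\gamma=1-\frac4{s-1}$, $\sin\theta\,b(\cos\theta)\sim K\theta^{-1-\nu}$ as $\theta\to0$, $\nu=\frac2{s-1}$, $K>0$. Momentum transfer: $M(|z|)=\int_{\mathbb{S}^2}B(z,\sigma)(1-k\cdot\sigma)\,d\sigma$. $C^\alpha_c(\mathbb{R}^3)$ is the closure of $C_c^\infty(\mathbb{R}^3)$ in the Hölder norm $\|u\|_{C^\alpha}=\sup|u|+\sup_{x\ne y}|u(x)-u(y)|/|x-y|^\alpha$, and $\|\cdot\|_{C^\alpha_c}$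 is this norm. *)

theory Defs
  imports "HOL-Analysis.Analysis" "HOL-Library.Landau_Symbols"
begin

section \<open>Surface measure on the unit sphere\<close>

text \<open>
  The surface measure of a Borel set \<open>A\<close> of the unit sphere of \<open>\<real>\<^sup>3\<close> is three times the volume of
  the solid cone \<open>{t *\<^sub>R x | t x. 0 < t \<and> t < 1 \<and> x \<in> A}\<close>: in polar coordinates the volume of that
  cone is the surface measure of \<open>A\<close> times \<open>\<integral> t\<^sup>2 dt\<close> over \<open>(0,1)\<close>. As \<^term>\<open>sgn x\<close> is
  \<open>x /\<^sub>R norm x\<close>, the cone is the preimage of \<open>A\<close> under \<^const>\<open>sgn\<close> in the punctured unit ball.
\<close>

definition sphere_measure :: "(real^3) measure" where
  "sphere_measure =
     scale_measure 3 (distr (restrict_space lborel (ball 0 1 - {0}))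
                            (restrict_space borel (sphere 0 1)) sgn)"

lemma space_sphere_measure [simp]: "space sphere_measure = sphere 0 1"
  by (simp add: sphere_measure_def space_scale_measure space_restrict_space)

lemma sets_sphere_measure [simp, measurable_cong]:
  "sets sphere_measure = sets (restrict_space borel (sphere 0 1))"
  by (simp add: sphere_measure_def)

lemma measurable_sgn_punctured_ball:
  "(sgn :: real^3 \<Rightarrow> real^3) \<in>
     measurable (restrict_space lborel (ball 0 1 - {0})) (restrict_space borel (sphere 0 1))"
proof (rule measurable_restrict_space2)
  show "(sgn :: real^3 \<Rightarrow> real^3) \<in> space (restrict_space lborel (ball 0 1 - {0})) \<rightarrow> sphere 0 1"
    by (auto simp: space_restrict_space norm_sgn)
  have "(\<lambda>x::real^3. x /\<^sub>R norm x) \<in> borel_measurable borel"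
    by measurable
  then have "(sgn :: real^3 \<Rightarrow> real^3) \<in> borel_measurable lborel"
    by (simp add: sgn_div_norm[abs_def])
  then show "(sgn :: real^3 \<Rightarrow> real^3) \<in>
      borel_measurable (restrict_space lborel (ball 0 1 - {0}))"
    by (rule measurable_restrict_space1)
qed

lemma emeasure_sphere_measure_UNIV: "emeasure sphere_measure (sphere 0 1) = ennreal (4 * pi)"
proof -
  let ?B = "ball 0 1 - {0 :: real^3}"
  have "emeasure (lborel :: (real^3) measure) ?B = emeasure lborel (ball 0 1 :: (real^3) set)"
    by (subst emeasure_Diff) auto
  also have "\<dots> = ennreal (4 / 3 * pi)"
    by (simp add: emeasure_ball unit_ball_vol_3)
  finally have B: "emeasure (lborel :: (real^3) measure) ?B = ennreal (4 / 3 * pi)" .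
  have "sphere 0 1 \<in> sets (restrict_space borel (sphere 0 (1::real) :: (real^3) set))"
    using sets.top[of "restrict_space borel (sphere 0 1 :: (real^3) set)"]
    by (simp add: space_restrict_space)
  then have "emeasure sphere_measure (sphere 0 1) =
      3 * emeasure (restrict_space lborel ?B) (sgn -` sphere 0 1 \<inter> ?B)"
    by (simp add: sphere_measure_def emeasure_distr[OF measurable_sgn_punctured_ball]
        space_restrict_space)
  also have "sgn -` sphere 0 1 \<inter> ?B = ?B"
    by (auto simp: norm_sgn)
  also have "emeasure (restrict_space lborel ?B) ?B = ennreal (4 / 3 * pi)"
    by (simp add: emeasure_restrict_space B)
  also have "3 * ennreal (4 / 3 * pi) = ennreal (4 * pi)"
    by (simp add: ennreal_mult'[symmetric] flip: ennreal_numeral)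
  finally show ?thesis .
qed

lemma lborel_distr_orthogonal:
  fixes f :: "real^3 \<Rightarrow> real^3"
  assumes f: "orthogonal_transformation f"
  shows "distr lborel borel f = lborel"
proof -
  have lin: "linear f" using f by (simp add: orthogonal_transformation_def)
  obtain g where g: "orthogonal_transformation g" "g = inv f"
    using orthogonal_transformation_inv[OF f] by blast
  have ling: "linear g" using g by (simp add: orthogonal_transformation_def)
  have bij: "bij f" by (rule orthogonal_transformation_bij[OF f])
  have meas: "f \<in> borel_measurable borel"
    using lin by (intro borel_measurable_continuous_onI linear_continuous_on)
      (simp add: linear_conv_bounded_linear)
  show ?thesis
  proof (rule lborel_eqI[symmetric])
    fix l u :: "real^3" assume le: "\<And>b. b \<in> Basis \<Longrightarrow> l \<bullet> b \<le> u \<bullet> b"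
    have vim: "f -` box l u = g ` box l u"
      using bij g(2) by (simp add: bij_vimage_eq_inv_image)
    have "emeasure (distr lborel borel f) (box l u) = emeasure lborel (f -` box l u)"
      using meas by (simp add: emeasure_distr)
    also have "\<dots> = emeasure lebesgue (g ` box l u)"
      using measurable_sets[OF meas, of "box l u"] vim by simp
    also have "\<dots> = ennreal (measure lebesgue (g ` box l u))"
      using measurable_linear_image[OF ling, of "box l u"]
      by (simp add: emeasure_eq_measure2 fmeasurableD2)
    also have "measure lebesgue (g ` box l u) = measure lebesgue (box l u)"
      using measure_orthogonal_image[OF g(1), of "box l u"] by simp
    finally show "emeasure (distr lborel borel f) (box l u) = ennreal (\<Prod>b\<in>Basis. (u - l) \<bullet> b)"
      using le by (simp add: measure_lborel_box inner_diff_left)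
  qed simp
qed

lemma distr_sphere_measure_orthogonal:
  assumes f: "orthogonal_transformation (f :: real^3 \<Rightarrow> real^3)"
  shows "distr sphere_measure sphere_measure f = sphere_measure"
proof (rule measure_eqI)
  have lin: "linear f" using f by (simp add: orthogonal_transformation_def)
  have nf: "norm (f x) = norm x" for x
    using f by (simp add: orthogonal_transformation)
  have f0: "f x = 0 \<longleftrightarrow> x = 0" for x
    using nf[of x] by (metis norm_eq_zero)
  have sgnf: "sgn (f x) = f (sgn x)" for x
    using lin by (simp add: sgn_div_norm nf linear_scale)
  have bf [measurable]: "f \<in> borel_measurable borel"
    using lin by (intro borel_measurable_continuous_onI linear_continuous_on)
      (simp add: linear_conv_bounded_linear)
  have mf: "f \<in> measurable sphere_measure sphere_measure"
    unfolding measurable_cong_sets[OF sets_sphere_measure sets_sphere_measure]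
    by (rule measurable_restrict_space2)
      (auto simp: space_restrict_space nf intro: measurable_restrict_space1)
  show "sets (distr sphere_measure sphere_measure f) = sets sphere_measure" by simp
  fix A :: "(real^3) set" assume "A \<in> sets (distr sphere_measure sphere_measure f)"
  then have A: "A \<in> sets sphere_measure" by simp
  let ?B = "ball 0 1 - {0 :: real^3}"
  have em: "emeasure sphere_measure S = 3 * emeasure lborel (sgn -` S \<inter> ?B)"
    if S: "S \<in> sets sphere_measure" for S
    using S emeasure_distr[OF measurable_sgn_punctured_ball, of S]
    by (simp add: sphere_measure_def space_restrict_space emeasure_restrict_space)
  have bs: "sgn -` S \<inter> ?B \<in> sets borel" if S: "S \<in> sets sphere_measure" for S
    using measurable_sets[OF measurable_sgn_punctured_ball, of S] S
    by (simp add: space_restrict_space sets_restrict_space_iff)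
  have fA: "f -` A \<inter> sphere 0 1 \<in> sets sphere_measure"
    using measurable_sets[OF mf A] by simp
  have "emeasure (distr sphere_measure sphere_measure f) A =
      emeasure sphere_measure (f -` A \<inter> sphere 0 1)"
    using A mf by (simp add: emeasure_distr)
  also have "\<dots> = 3 * emeasure lborel (sgn -` (f -` A \<inter> sphere 0 1) \<inter> ?B)"
    by (rule em[OF fA])
  also have "sgn -` (f -` A \<inter> sphere 0 1) \<inter> ?B = f -` (sgn -` A \<inter> ?B)"
    by (auto simp: sgnf norm_sgn nf f0)
  also have "emeasure lborel (f -` (sgn -` A \<inter> ?B)) =
      emeasure (distr lborel borel f) (sgn -` A \<inter> ?B)"
    using bs[OF A] by (simp add: emeasure_distr)
  also have "\<dots> = emeasure lborel (sgn -` A \<inter> ?B)"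
    by (simp add: lborel_distr_orthogonal[OF f])
  also have "3 * \<dots> = emeasure sphere_measure A"
    by (rule em[OF A, symmetric])
  finally show "emeasure (distr sphere_measure sphere_measure f) A = emeasure sphere_measure A" .
qed


section \<open>Collision kernel\<close>

definition collision_kernel ::
    "real \<Rightarrow> (real \<Rightarrow> real) \<Rightarrow> real^3 \<Rightarrow> real^3 \<Rightarrow> real" where
  "collision_kernel \<gamma> b z \<sigma> = norm z powr \<gamma> * b ((z /\<^sub>R norm z) \<bullet> \<sigma>)"

definition post_velocity :: "real^3 \<Rightarrow> real^3 \<Rightarrow> real^3 \<Rightarrow> real^3" where
  "post_velocity v vs \<sigma> = (v + vs) /\<^sub>R 2 + (norm (v - vs) / 2) *\<^sub>R \<sigma>"

definition collision_transform ::
    "real \<Rightarrow> (real \<Rightarrow> real) \<Rightarrow> real^3 \<Rightarrow> (real^3 \<Rightarrow> real) \<Rightarrow> real^3 \<Rightarrow> real" where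
  "collision_transform \<gamma> b vs \<phi> v =
     (LINT \<sigma>|sphere_measure.
        collision_kernel \<gamma> b (v - vs) \<sigma> * (\<phi> (post_velocity v vs \<sigma>) - \<phi> v))"

text \<open>
  The momentum transfer is a function of the relative speed \<open>r\<close>; the direction of the relative
  velocity used to write it down is irrelevant, see \<open>momentum_transfer_norm\<close>.
\<close>

definition momentum_transfer :: "real \<Rightarrow> (real \<Rightarrow> real) \<Rightarrow> real \<Rightarrow> real" where
  "momentum_transfer \<gamma> b r =
     (LINT \<sigma>|sphere_measure.
        collision_kernel \<gamma> b (r *\<^sub>R axis 1 1) \<sigma> * (1 - axis 1 1 \<bullet> \<sigma>))"

lemma momentum_transfer_norm:
  assumes b: "b \<in> borel_measurable (restrict_space borel {-1..1})"
  shows "momentum_transfer \<gamma> b (norm z) =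
     (LINT \<sigma>|sphere_measure. collision_kernel \<gamma> b z \<sigma> * (1 - (z /\<^sub>R norm z) \<bullet> \<sigma>))"
proof (cases "z = 0")
  case True
  then show ?thesis by (simp add: momentum_transfer_def collision_kernel_def)
next
  case False
  define k where "k = z /\<^sub>R norm z"
  define e :: "real^3" where "e = axis 1 1"
  have nk: "norm k = 1" and ne: "norm e = 1" using False by (auto simp: k_def e_def)
  obtain f where f: "orthogonal_transformation f" "f e = k"
    using orthogonal_transformation_exists_1[OF ne nk] by blast
  have lin: "linear f" using f by (simp add: orthogonal_transformation_def)
  have bf [measurable]: "f \<in> borel_measurable borel"
    using lin by (intro borel_measurable_continuous_onI linear_continuous_on)
      (simp add: linear_conv_bounded_linear)
  have nf: "norm (f x) = norm x" for x
    using f by (simp add: orthogonal_transformation)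
  have mf: "f \<in> measurable sphere_measure sphere_measure"
    unfolding measurable_cong_sets[OF sets_sphere_measure sets_sphere_measure]
    by (rule measurable_restrict_space2)
      (auto simp: space_restrict_space nf intro: measurable_restrict_space1)
  define F where "F \<sigma> = norm z powr \<gamma> * b (k \<bullet> \<sigma>) * (1 - k \<bullet> \<sigma>)" for \<sigma>
  have "(\<lambda>\<sigma>. k \<bullet> \<sigma>) \<in> measurable sphere_measure (restrict_space borel {-1..1})"
    unfolding measurable_cong_sets[OF sets_sphere_measure refl]
  proof (rule measurable_restrict_space2)
    show "(\<lambda>\<sigma>. k \<bullet> \<sigma>) \<in> space (restrict_space borel (sphere 0 1)) \<rightarrow> {-1..1}"
    proof
      fix \<sigma> assume "\<sigma> \<in> space (restrict_space borel (sphere 0 1 :: (real^3) set))"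
      then have "norm \<sigma> = 1" by (simp add: space_restrict_space)
      then show "k \<bullet> \<sigma> \<in> {-1..1}"
        using Cauchy_Schwarz_ineq2[of k \<sigma>] nk by (simp add: abs_le_iff)
    qed
  qed (auto intro: measurable_restrict_space1)
  then have "(\<lambda>\<sigma>. b (k \<bullet> \<sigma>)) \<in> borel_measurable sphere_measure"
    using b by (rule measurable_compose)
  moreover have "(\<lambda>\<sigma>. k \<bullet> \<sigma>) \<in> borel_measurable sphere_measure"
    unfolding measurable_cong_sets[OF sets_sphere_measure refl]
    by (auto intro: measurable_restrict_space1)
  ultimately have mF: "F \<in> borel_measurable sphere_measure"
    unfolding F_def by measurable
  have inner: "k \<bullet> f \<sigma> = e \<bullet> \<sigma>" for \<sigma>
    using f by (metis orthogonal_transformation_def)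
  have "(LINT \<sigma>|sphere_measure. F \<sigma>) = (LINT \<sigma>|distr sphere_measure sphere_measure f. F \<sigma>)"
    by (simp add: distr_sphere_measure_orthogonal[OF f(1)])
  also have "\<dots> = (LINT \<sigma>|sphere_measure. F (f \<sigma>))"
    by (rule integral_distr[OF mf mF])
  also have "\<dots> = momentum_transfer \<gamma> b (norm z)"
    using False unfolding momentum_transfer_def
    by (intro Bochner_Integration.integral_cong)
      (auto simp: F_def inner collision_kernel_def e_def)
  finally show ?thesis
    by (simp add: F_def[abs_def] collision_kernel_def k_def)
qed


section \<open>Hoelder spaces\<close>

text \<open>\<open>C_k n f\<close>: all partial derivatives of \<open>f\<close> of order at most \<open>n\<close> exist and are continuous.\<close>

fun C_k :: "nat \<Rightarrow> ('a::euclidean_space \<Rightarrow> real) \<Rightarrow> bool" where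
  "C_k 0 f \<longleftrightarrow> continuous_on UNIV f"
| "C_k (Suc n) f \<longleftrightarrow>
     (\<forall>x. f differentiable at x) \<and> (\<forall>i\<in>Basis. C_k n (\<lambda>x. frechet_derivative f (at x) i))"

definition test_functions :: "('a::euclidean_space \<Rightarrow> real) set" where
  "test_functions = {f. (\<forall>n. C_k n f) \<and> compact (closure {x. f x \<noteq> 0})}"

text \<open>
  The norm takes values in \<^typ>\<open>ennreal\<close> so that the suprema are meaningful for every function.
\<close>

definition holder_enorm :: "real \<Rightarrow> ('a::euclidean_space \<Rightarrow> real) \<Rightarrow> ennreal" where
  "holder_enorm \<alpha> u =
     (SUP x. ennreal \<bar>u x\<bar>) +
     (SUP (x, y)\<in>{(x, y). x \<noteq> y}. ennreal (\<bar>u x - u y\<bar> / norm (x - y) powr \<alpha>))"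

text \<open>Only used for functions of finite norm, in particular on \<open>holder_c\<close> below.\<close>

definition holder_norm :: "real \<Rightarrow> ('a::euclidean_space \<Rightarrow> real) \<Rightarrow> real" where
  "holder_norm \<alpha> u = enn2real (holder_enorm \<alpha> u)"

definition holder_c :: "real \<Rightarrow> ('a::euclidean_space \<Rightarrow> real) set" where
  "holder_c \<alpha> =
     {u. holder_enorm \<alpha> u < \<infinity> \<and>
         (\<forall>\<epsilon>>0. \<exists>f\<in>test_functions. holder_enorm \<alpha> (\<lambda>x. u x - f x) < ennreal \<epsilon>)}"

end

theory Submission
  imports Defs
begin

text \<open>
  With \<open>r = |v - v\<^sub>*|\<close> and \<open>t = k \<bullet> \<sigma>\<close> one has \<open>|v' - v| = r \<surd>((1 - t)/2)\<close>, so a Hoelder function makes the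
  integrand at most \<open>\<parallel>\<phi>\<parallel> r\<^bsup>\<alpha>+\<gamma>\<^esup> b(t) ((1 - t)/2)\<^bsup>\<alpha>/2\<^esup>\<close>. Away from \<open>t = 1\<close> this weight is controlled by
  \<open>b(t) (1 - t)\<close>, which is integrable because the momentum transfer is finite. Near \<open>t = 1\<close> the
  singularity of \<open>b\<close> gives the bound \<open>(1 - t)\<^bsup>-p\<^esup>\<close> with \<open>p = 1 - (\<alpha> - \<nu>)/2 < 1\<close>, and the cap
  \<open>1 - t \<le> h\<close> has measure \<open>O(h)\<close>. By rotation invariance the integral of the weight does not depend
  on \<open>k\<close>. The second inequality holds with equality, as \<open>M(r) = m r\<^bsup>\<gamma>\<^esup>\<close> with \<open>m > 0\<close>.
\<close>

section \<open>Zonal functions, caps and segments on the unit sphere\<close>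

lemma emeasure_sphere_measure:
  assumes S: "S \<in> sets sphere_measure"
  shows "emeasure sphere_measure S = 3 * emeasure lborel (sgn -` S \<inter> (ball 0 1 - {0}))"
  using S emeasure_distr[OF measurable_sgn_punctured_ball, of S]
  by (simp add: sphere_measure_def space_restrict_space emeasure_restrict_space)

lemma borel_measurable_sphere_measureI:
  "f \<in> borel_measurable borel \<Longrightarrow> f \<in> borel_measurable sphere_measure"
  unfolding measurable_cong_sets[OF sets_sphere_measure refl]
  by (rule measurable_restrict_space1)

lemma inner_unit_bounds:
  fixes k \<sigma> :: "'a::real_inner"
  assumes "norm k = 1" "norm \<sigma> = 1"
  shows "k \<bullet> \<sigma> \<in> {-1..1}"
  using Cauchy_Schwarz_ineq2[of k \<sigma>] assms by (simp add: abs_le_iff)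

lemma measurable_inner_sphere_measure:
  assumes "norm k = 1"
  shows "(\<lambda>\<sigma>. k \<bullet> \<sigma>) \<in> measurable sphere_measure (restrict_space borel {-1..1})"
  unfolding measurable_cong_sets[OF sets_sphere_measure refl]
  by (rule measurable_restrict_space2)
    (use assms inner_unit_bounds[of k] in \<open>auto simp: space_restrict_space intro: measurable_restrict_space1\<close>)

text \<open>Some orthogonal map \<open>f\<close> carries \<open>e\<close> to \<open>k\<close>; it
  preserves the surface measure and satisfies
  \<open>k \<bullet> f \<sigma> = e \<bullet> \<sigma>\<close>. Every later computation can
  therefore be done at the fixed pole \<open>axis 1 1\<close>, which makes the constants independent
  of the direction of the relative velocity.\<close>

lemma sphere_measure_zonal_eq:
  fixes g :: "real \<Rightarrow> real"
  assumes g: "g \<in> borel_measurable (restrict_space borel {-1..1})"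
    and ne: "norm e = 1" and nk: "norm k = 1"
  shows "integrable sphere_measure (\<lambda>\<sigma>. g (k \<bullet> \<sigma>)) \<longleftrightarrow> integrable sphere_measure (\<lambda>\<sigma>. g (e \<bullet> \<sigma>))"
    and "(LINT \<sigma>|sphere_measure. g (k \<bullet> \<sigma>)) = (LINT \<sigma>|sphere_measure. g (e \<bullet> \<sigma>))"
proof -
  obtain f where f: "orthogonal_transformation f" "f e = k"
    using orthogonal_transformation_exists_1[OF ne nk] by blast
  have "continuous_on UNIV f"
    using f(1) by (intro linear_continuous_on)
      (simp add: linear_conv_bounded_linear orthogonal_transformation_def)
  then have [measurable]: "f \<in> borel_measurable borel"
    by (rule borel_measurable_continuous_onI)
  have mf: "f \<in> measurable sphere_measure sphere_measure"
    unfolding measurable_cong_sets[OF sets_sphere_measure sets_sphere_measure]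
    by (rule measurable_restrict_space2)
      (use f(1) in \<open>auto simp: space_restrict_space orthogonal_transformation
         intro: measurable_restrict_space1\<close>)
  have mg: "(\<lambda>\<sigma>. g (k \<bullet> \<sigma>)) \<in> borel_measurable sphere_measure"
    using measurable_inner_sphere_measure[OF nk] g by (rule measurable_compose)
  have inner: "k \<bullet> f \<sigma> = e \<bullet> \<sigma>" for \<sigma>
    using f by (metis orthogonal_transformation_def)
  show "integrable sphere_measure (\<lambda>\<sigma>. g (k \<bullet> \<sigma>)) \<longleftrightarrow> integrable sphere_measure (\<lambda>\<sigma>. g (e \<bullet> \<sigma>))"
    using integrable_distr_eq[OF mf mg]
    by (simp add: inner distr_sphere_measure_orthogonal[OF f(1)])
  show "(LINT \<sigma>|sphere_measure. g (k \<bullet> \<sigma>)) = (LINT \<sigma>|sphere_measure. g (e \<bullet> \<sigma>))"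
    using integral_distr[OF mf mg]
    by (simp add: inner distr_sphere_measure_orthogonal[OF f(1)])
qed

lemma cap_in_sets_sphere_measure:
  "{\<sigma> \<in> space sphere_measure. 1 - axis 1 1 \<bullet> \<sigma> \<le> h} \<in> sets sphere_measure"
proof -
  have "(\<lambda>\<sigma>::real^3. 1 - axis 1 1 \<bullet> \<sigma>) \<in> borel_measurable sphere_measure"
    by (rule borel_measurable_sphere_measureI) measurable
  then show ?thesis by measurable
qed

text \<open>The cone over the cap lies in the box \<open>[-1,1] \<times> [-\<surd>(2h), \<surd>(2h)]\<^sup>2\<close>.\<close>

lemma emeasure_cap_le:
  assumes h: "0 \<le> h" "h \<le> 1"
  shows "emeasure sphere_measure {\<sigma> \<in> space sphere_measure. 1 - axis 1 1 \<bullet> \<sigma> \<le> h}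
    \<le> ennreal (48 * h)"
proof -
  define w where "w = sqrt (2 * h)"
  define a c :: "real^3" where "a = vector [-1, -w, -w]" and "c = vector [1, w, w]"
  have w0: "0 \<le> w" using h by (simp add: w_def)
  let ?S = "{\<sigma> \<in> space sphere_measure. 1 - axis 1 1 \<bullet> \<sigma> \<le> h}"
  have sub: "sgn -` ?S \<inter> (ball 0 1 - {0}) \<subseteq> cbox a c"
  proof
    fix x :: "real^3" assume "x \<in> sgn -` ?S \<inter> (ball 0 1 - {0})"
    then have x0: "x \<noteq> 0" and x1: "norm x < 1" and cap: "1 - sgn x $ 1 \<le> h"
      by (auto simp: inner_axis')
    have "x $ 1 = sgn x $ 1 * norm x" using x0 by (simp add: sgn_div_norm)
    moreover have "(1 - h) * norm x \<le> sgn x $ 1 * norm x"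
      using cap by (intro mult_right_mono) auto
    ultimately have x1h: "(1 - h) * norm x \<le> x $ 1" by simp
    have nrm: "(norm x)\<^sup>2 = (x $ 1)\<^sup>2 + (x $ 2)\<^sup>2 + (x $ 3)\<^sup>2"
      by (simp only: power2_norm_eq_inner inner_vec_def sum_3) (simp add: power2_eq_square)
    \<comment> \<open>Squaring the inequality needs \<open>0 \<le> 1 - h\<close>, which is where
      \<open>h \<le> 1\<close> enters. Subtracting the result from \<open>nrm\<close> bounds the
      distance of \<open>x\<close> from the axis.\<close>
    have "((1 - h) * norm x)\<^sup>2 \<le> (x $ 1)\<^sup>2"
      using x1h h by (intro power_mono) auto
    moreover have "((1 - h) * norm x)\<^sup>2 = (norm x)\<^sup>2 - (2 * h - h\<^sup>2) * (norm x)\<^sup>2"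
      by (simp add: power2_eq_square algebra_simps)
    ultimately have "(x $ 2)\<^sup>2 + (x $ 3)\<^sup>2 \<le> (2 * h - h\<^sup>2) * (norm x)\<^sup>2"
      using nrm by linarith
    also have "\<dots> \<le> (2 * h) * 1"
      using h x1 by (intro mult_mono) (auto simp: power_le_one)
    finally have "(x $ 2)\<^sup>2 + (x $ 3)\<^sup>2 \<le> w\<^sup>2" using h by (simp add: w_def)
    then have "(x $ 2)\<^sup>2 \<le> w\<^sup>2" "(x $ 3)\<^sup>2 \<le> w\<^sup>2"
      using zero_le_power2[of "x $ 2"] zero_le_power2[of "x $ 3"] by linarith+
    then have "\<bar>x $ 2\<bar> \<le> w" "\<bar>x $ 3\<bar> \<le> w"
      using w0 by (auto simp: abs_le_square_iff[symmetric])
    moreover have "\<bar>x $ 1\<bar> \<le> 1" using component_le_norm_cart[of x 1] x1 by linarith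
    ultimately show "x \<in> cbox a c"
      by (auto simp: mem_box_cart forall_3 a_def c_def)
  qed
  have "0 \<in> cbox a c" using w0 by (simp add: mem_box_cart forall_3 a_def c_def)
  then have "cbox a c \<noteq> {}" by blast
  then have "measure lborel (cbox a c) = 2 * (2 * w) * (2 * w)"
    by (subst content_cbox_cart, assumption) (simp only: UNIV_3, simp add: a_def c_def)
  also have "\<dots> = 16 * h" using h by (simp add: w_def)
  finally have box: "emeasure lborel (cbox a c) = ennreal (16 * h)"
    using emeasure_lborel_cbox_finite[of a c] by (metis emeasure_eq_ennreal_measure less_irrefl infinity_ennreal_def)
  have "emeasure sphere_measure ?S = 3 * emeasure lborel (sgn -` ?S \<inter> (ball 0 1 - {0}))"
    by (rule emeasure_sphere_measure[OF cap_in_sets_sphere_measure])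
  also have "\<dots> \<le> 3 * emeasure lborel (cbox a c)"
    by (intro mult_left_mono emeasure_mono sub) auto
  also have "\<dots> = ennreal (48 * h)"
    using h by (simp add: box ennreal_mult'[symmetric] flip: ennreal_numeral)
  finally show ?thesis .
qed

lemma emeasure_lborel_open_nonzero:
  fixes U :: "'a::euclidean_space set"
  assumes "open U" "U \<noteq> {}"
  shows "emeasure lborel U \<noteq> 0"
  using assms open_not_negligible[of U] negligible_iff_emeasure0[of U] by (simp add: borel_open)

text \<open>The cone over the segment is open and nonempty, so it has positive volume. The strict
  upper bound leaves out the pole, where the weight 1 - t of the momentum transfer vanishes.\<close>

lemma emeasure_spherical_segment_nonzero:
  fixes c :: real
  assumes c: "0 < c" "c \<le> 1"
  shows "emeasure sphere_measure
    {\<sigma> \<in> space sphere_measure. 1 - c < axis 1 1 \<bullet> \<sigma> \<and> axis 1 1 \<bullet> \<sigma> < 1} \<noteq> 0"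
proof -
  let ?S = "{\<sigma> \<in> space sphere_measure. 1 - c < axis 1 1 \<bullet> \<sigma> \<and> axis 1 1 \<bullet> \<sigma> < 1}"
  let ?U = "sgn -` ?S \<inter> (ball 0 1 - {0 :: real^3})"
  have [measurable]: "(\<lambda>\<sigma>::real^3. axis 1 1 \<bullet> \<sigma>) \<in> borel_measurable sphere_measure"
    by (rule borel_measurable_sphere_measureI) measurable
  have S: "?S \<in> sets sphere_measure" by measurable
  have comp: "axis 1 1 \<bullet> sgn x = x $ 1 / norm x" for x :: "real^3"
    by (simp add: inner_axis' sgn_div_norm divide_inverse_commute)
  have U: "?U = (ball 0 1 - {0}) \<inter> (\<lambda>x. x $ 1 / norm x) -` {1 - c<..<1}"
    by (auto simp: comp norm_sgn)
  have cont: "continuous_on (ball 0 1 - {0}) (\<lambda>x::real^3. x $ 1 / norm x)"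
    by (intro continuous_intros) auto
  have opn: "open ?U"
    unfolding U
    by (intro continuous_open_preimage cont open_Diff) auto
  \<comment> \<open>\<open>q\<close> is the midpoint of the interval (1 - c, 1), and
    \<open>x\<close> is a vector of length 1/2 whose direction has first coordinate
    \<open>q\<close>; the length keeps it inside the punctured ball.\<close>
  define q where "q = 1 - c / 2"
  define x :: "real^3" where "x = vector [q / 2, sqrt (1 - q\<^sup>2) / 2, 0]"
  have q: "0 < q" "q < 1" "1 - c < q" using c by (auto simp: q_def)
  then have q2: "q\<^sup>2 < 1" by (simp add: power_less_one_iff)
  have nx: "norm x = 1 / 2"
    using q2 by (simp add: norm_vec_def L2_set_def sum_3 x_def power_divide
        add_divide_distrib[symmetric] real_sqrt_divide)
  moreover have "x \<noteq> 0" "norm x < 1" using nx by auto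
  moreover have "x $ 1 / norm x = q" unfolding nx by (simp add: x_def)
  ultimately have "x \<in> ?U"
    unfolding U using q by simp
  then have "emeasure lborel ?U \<noteq> 0" by (intro emeasure_lborel_open_nonzero opn) blast
  then show ?thesis
    unfolding emeasure_sphere_measure[OF S] mult_eq_0_iff by simp
qed

section \<open>Integrability of inverse powers at the pole\<close>

text \<open>Dyadic decomposition of the set where \<open>0 < f \<le> 1\<close>.\<close>

lemma nn_integral_powr_neg_finite:
  fixes f :: "'a \<Rightarrow> real"
  assumes [measurable]: "f \<in> borel_measurable M"
    and p: "0 < p" "p < 1" and A: "0 \<le> A"
    and level: "\<And>h. 0 \<le> h \<Longrightarrow> h \<le> 1 \<Longrightarrow> emeasure M {x \<in> space M. f x \<le> h} \<le> ennreal (A * h)"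
  shows "(\<integral>\<^sup>+x. ennreal (f x powr (-p) * indicator {0<..1} (f x)) \<partial>M) < \<infinity>"
proof -
  define S where "S n = {x \<in> space M. f x \<le> (1/2)^n}" for n :: nat
  \<comment> \<open>\<open>a n\<close> is the value of \<open>y powr (-p)\<close> at y =
    (1/2)^(n+1), the lower end of the dyadic shell (1/2)^(n+1) < y \<le> (1/2)^n, and hence an upper
    bound on that shell.\<close>
  define a where "a n = 2 powr (real (Suc n) * p)" for n :: nat
  have [measurable]: "S n \<in> sets M" for n unfolding S_def by measurable
  have pt: "ennreal (f x powr (-p) * indicator {0<..1} (f x))
      \<le> (\<Sum>n. ennreal (a n) * indicator (S n) x)" if x: "x \<in> space M" for x
  proof (cases "0 < f x \<and> f x \<le> 1")
    case True
    \<comment> \<open>The first power of 1/2 below \<open>f x\<close> locates the shell of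
      \<open>x\<close>. It is not the power 0 because \<open>f x \<le> 1\<close>, so
      \<open>N\<close> has a predecessor \<open>n\<close>, and minimality puts \<open>x\<close> into
      \<open>S n\<close>.\<close>
    define N where "N = (LEAST n. (1/2)^n < f x)"
    obtain m where "(1/2)^m < f x" using True real_arch_pow_inv[of "f x" "1/2"] by auto
    then have N: "(1/2)^N < f x" unfolding N_def by (rule LeastI)
    have "N \<noteq> 0" using N True by (metis not_le power_0)
    then obtain n where n: "N = Suc n" by (cases N) auto
    have "\<not> (1/2)^n < f x" using not_less_Least[of n "\<lambda>n. (1/2)^n < f x"] n by (simp add: N_def)
    then have "x \<in> S n" using x by (simp add: S_def)
    have "f x powr (-p) \<le> ((1/2)^Suc n) powr (-p)"
      using p N n by (intro powr_mono2') auto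
    also have "(1/2)^Suc n = 2 powr (- real (Suc n))"
      by (simp only: powr_minus powr_realpow zero_less_numeral power_one_over inverse_eq_divide)
    also have "(2 powr (- real (Suc n))) powr (-p) = a n"
      by (simp only: powr_powr a_def mult_minus_left mult_minus_right minus_minus)
    finally have "ennreal (f x powr (-p) * indicator {0<..1} (f x)) \<le> ennreal (a n) * indicator (S n) x"
      using True \<open>x \<in> S n\<close> by (simp add: ennreal_leI)
    also have "\<dots> = (\<Sum>k\<in>{n}. ennreal (a k) * indicator (S k) x)"
      by (simp del: sum_mult_indicator)
    also have "\<dots> \<le> (\<Sum>k. ennreal (a k) * indicator (S k) x)"
      by (rule sum_le_suminf) auto
    finally show ?thesis .
  qed auto
  \<comment> \<open>The n-th term is the weight 2^((n+1)p) times the measure bound A 2^(-n). The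
    ratio is 2^(p-1), which is below 1 exactly because \<open>p < 1\<close>.\<close>
  have sums: "summable (\<lambda>n. A * 2 powr p * (2 powr (p - 1)) ^ n)"
    using p by (intro summable_mult summable_geometric) (auto simp: powr_less_one)
  have "(\<integral>\<^sup>+x. ennreal (f x powr (-p) * indicator {0<..1} (f x)) \<partial>M)
      \<le> (\<integral>\<^sup>+x. (\<Sum>n. ennreal (a n) * indicator (S n) x) \<partial>M)"
    by (intro nn_integral_mono pt)
  also have "\<dots> = (\<Sum>n. \<integral>\<^sup>+x. ennreal (a n) * indicator (S n) x \<partial>M)"
    by (rule nn_integral_suminf) measurable
  also have "\<dots> = (\<Sum>n. ennreal (a n) * emeasure M (S n))"
    by (simp add: nn_integral_cmult_indicator)
  also have "\<dots> \<le> (\<Sum>n. ennreal (A * 2 powr p * (2 powr (p - 1)) ^ n))"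
  proof (intro suminf_le)
    fix n
    have "ennreal (a n) * emeasure M (S n) \<le> ennreal (a n) * ennreal (A * (1/2)^n)"
      unfolding S_def by (intro mult_left_mono level) (auto simp: power_le_one)
    also have "\<dots> = ennreal (a n * (A * (1/2)^n))"
      using A by (simp add: ennreal_mult a_def)
    also have "a n * (A * (1/2)^n) = A * 2 powr p * (2 powr (p - 1)) ^ n"
    proof -
      have "(2 powr (p - 1)) ^ n = 2 powr (real n * (p - 1))"
        by (simp add: powr_realpow[symmetric] powr_powr mult.commute)
      also have "\<dots> = 2 powr (real n * p) * (1/2)^n"
        by (simp add: right_diff_distrib powr_diff powr_realpow power_one_over field_simps)
      finally show ?thesis by (simp add: a_def distrib_right powr_add)
    qed
    finally show "ennreal (a n) * emeasure M (S n) \<le> ennreal (A * 2 powr p * (2 powr (p - 1)) ^ n)" .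
  qed auto
  also have "\<dots> < \<infinity>"
    using A sums by (subst suminf_ennreal2) auto
  finally show ?thesis .
qed

text \<open>The level sets of 1 - t, where t is the first coordinate, are caps, so the linear cap
  bound supplies the constant 48 for the dyadic estimate.\<close>

lemma integrable_cap_powr:
  fixes p :: real
  assumes p: "0 < p" "p < 1"
  shows "integrable sphere_measure
    (\<lambda>\<sigma>. (1 - axis 1 1 \<bullet> \<sigma>) powr (-p) * indicator {0<..1} (1 - axis 1 1 \<bullet> \<sigma>))"
proof (rule integrableI_nonneg)
  have m: "(\<lambda>\<sigma>::real^3. 1 - axis 1 1 \<bullet> \<sigma>) \<in> borel_measurable sphere_measure"
    by (rule borel_measurable_sphere_measureI) measurable
  then show "(\<lambda>\<sigma>. (1 - axis 1 1 \<bullet> \<sigma>) powr (-p) * indicator {0<..1} (1 - axis 1 1 \<bullet> \<sigma>))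
      \<in> borel_measurable sphere_measure"
    by measurable
  show "(\<integral>\<^sup>+\<sigma>. ennreal ((1 - axis 1 1 \<bullet> \<sigma>) powr (-p) *
      indicator {0<..1} (1 - axis 1 1 \<bullet> \<sigma>)) \<partial>sphere_measure) < \<infinity>"
    by (rule nn_integral_powr_neg_finite[OF m p, of 48]) (use emeasure_cap_le in auto)
qed auto

section \<open>The angular singularity in the variable t = cos \<theta>\<close>

text \<open>Near \<theta> = 0 the quotient of the two asymptotically equivalent functions lies in
  (0, 2). The passage to t = cos \<theta> rests on
  \<open>sqrt (1 - t) \<le> sin \<theta> \<le> \<theta>\<close>: one factor sqrt(1 - t) comes from
  dividing by the sine, the others from the power of \<theta>. The upper bound serves integrability,
  the strict positivity serves the lower bound on the momentum transfer.\<close>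

lemma kernel_bounds_near_one:
  fixes b :: "real \<Rightarrow> real"
  assumes sing: "(\<lambda>\<theta>. sin \<theta> * b (cos \<theta>)) \<sim>[at_right 0] (\<lambda>\<theta>. K * \<theta> powr (- 1 - \<nu>))"
    and K: "0 < K" and \<nu>: "0 \<le> \<nu>"
  obtains c where "0 < c" "c \<le> 1"
    "\<And>t. 1 - c < t \<Longrightarrow> t < 1 \<Longrightarrow> 0 < b t \<and> b t \<le> 2 * K * (1 - t) powr (- 1 - \<nu> / 2)"
proof -
  have gpos: "eventually (\<lambda>\<theta>. 0 < K * \<theta> powr (- 1 - \<nu>)) (at_right 0)"
    using K by (auto simp: eventually_at_right[of 0 1])
  then have "((\<lambda>\<theta>. sin \<theta> * b (cos \<theta>) / (K * \<theta> powr (- 1 - \<nu>))) \<longlongrightarrow> 1) (at_right 0)"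
    by (intro asymp_equivD_strong[OF sing]) (auto elim: eventually_mono)
  then have "eventually (\<lambda>\<theta>. dist (sin \<theta> * b (cos \<theta>) / (K * \<theta> powr (- 1 - \<nu>))) 1 < 1) (at_right 0)"
    by (rule tendstoD) simp
  then have "eventually (\<lambda>\<theta>. 0 < sin \<theta> * b (cos \<theta>) \<and>
      sin \<theta> * b (cos \<theta>) \<le> 2 * K * \<theta> powr (- 1 - \<nu>)) (at_right 0)"
    using gpos
  proof eventually_elim
    case (elim \<theta>)
    let ?f = "sin \<theta> * b (cos \<theta>)" and ?g = "K * \<theta> powr (- 1 - \<nu>)"
    have "0 < ?f / ?g" "?f / ?g < 2" using elim(1) by (auto simp: dist_real_def abs_less_iff)
    then have "0 < ?f" "?f < 2 * ?g"
      using elim(2) by (auto simp: zero_less_divide_iff divide_less_eq)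
    then show ?case by (simp add: mult.assoc)
  qed
  then obtain \<epsilon> where \<epsilon>: "0 < \<epsilon>" and b: "\<And>\<theta>. 0 < \<theta> \<Longrightarrow> \<theta> < \<epsilon> \<Longrightarrow>
      0 < sin \<theta> * b (cos \<theta>) \<and> sin \<theta> * b (cos \<theta>) \<le> 2 * K * \<theta> powr (- 1 - \<nu>)"
    by (auto simp: eventually_at_right[of 0 1])
  \<comment> \<open>Capping at 1 keeps \<delta> below pi/2, so cos \<delta> > 0. Thus t stays
    positive and the final choice c = 1 - cos \<delta> is at most 1.\<close>
  define \<delta> where "\<delta> = min \<epsilon> 1"
  have \<delta>: "0 < \<delta>" "\<delta> < pi / 2" "\<delta> \<le> \<epsilon>"
    using \<epsilon> pi_gt3 by (auto simp: \<delta>_def min_def)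
  have "cos \<delta> < 1" using \<delta> cos_monotone_0_pi[of 0 \<delta>] by simp
  moreover have cos0: "0 < cos \<delta>" using \<delta> by (intro cos_gt_zero) auto
  moreover have "0 < b t \<and> b t \<le> 2 * K * (1 - t) powr (- 1 - \<nu> / 2)"
    if t: "cos \<delta> < t" "t < 1" for t
  proof -
    define \<theta> where "\<theta> = arccos t"
    define y where "y = 1 - t"
    have t0: "0 < t" using cos0 t by linarith
    have y: "0 < y" using t by (simp add: y_def)
    have ct: "cos \<theta> = t" using t t0 by (simp add: \<theta>_def cos_arccos)
    have "0 < \<theta>" using t t0 arccos_less_arccos[of t 1] by (simp add: \<theta>_def)
    moreover have "\<theta> < \<delta>"
      using t t0 \<delta> cos0 arccos_less_arccos[of "cos \<delta>" t] by (simp add: \<theta>_def arccos_cos)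
    ultimately have bt: "0 < sin \<theta> * b t" "sin \<theta> * b t \<le> 2 * K * \<theta> powr (- 1 - \<nu>)"
      using b[of \<theta>] \<delta> ct by auto
    have st: "0 < sin \<theta>" using \<open>0 < \<theta>\<close> \<open>\<theta> < \<delta>\<close> \<delta> by (intro sin_gt_zero) auto
    \<comment> \<open>For 0 < t < 1 one has 1 - t \<le> 1 - t^2, and the latter is the squared
      sine.\<close>
    have "y \<le> (sin \<theta>)\<^sup>2"
    proof -
      have "t * t \<le> t * 1" using t t0 by (intro mult_left_mono) auto
      then show ?thesis by (simp add: sin_squared_eq ct y_def) (simp add: power2_eq_square)
    qed
    then have sy: "sqrt y \<le> sin \<theta>" using st by (simp add: real_le_lsqrt)
    moreover have "sin \<theta> \<le> \<theta>" using \<open>0 < \<theta>\<close> by (intro sin_x_le_x) auto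
    ultimately have "sqrt y \<le> \<theta>" by linarith
    then have "\<theta> powr (- 1 - \<nu>) \<le> sqrt y powr (- 1 - \<nu>)"
      using y \<nu> by (intro powr_mono2') auto
    \<comment> \<open>Since \<open>sin \<theta>\<close> is positive, \<open>bt\<close> gives
      \<open>0 < b t\<close>. So replacing \<open>sin \<theta>\<close> by the smaller
      \<open>sqrt y\<close> lowers the left side, while the negative exponent makes the right side
      grow.\<close>
    then have "sqrt y * b t \<le> 2 * K * sqrt y powr (- 1 - \<nu>)"
      using bt sy st K
      by (smt (verit) mult_left_mono mult_right_mono zero_less_mult_pos)
    then have "b t \<le> 2 * K * (sqrt y powr (- 1 - \<nu>) / sqrt y)"
      using y by (simp add: field_simps)
    also have "sqrt y powr (- 1 - \<nu>) / sqrt y = y powr (- 1 - \<nu> / 2)"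
    proof -
      have "sqrt y powr (- 1 - \<nu>) / sqrt y = y powr ((1/2) * (- 1 - \<nu>) - 1/2)"
        using y powr_diff[of y "(1/2) * (- 1 - \<nu>)" "1/2"]
        by (simp only: powr_half_sqrt[symmetric] powr_powr less_imp_le)
      also have "(1/2) * (- 1 - \<nu>) - 1/2 = - 1 - \<nu> / 2" by (simp add: field_simps)
      finally show ?thesis .
    qed
    finally show ?thesis
      using bt(1) st by (simp add: y_def zero_less_mult_iff)
  qed
  ultimately show thesis
    by (intro that[of "1 - cos \<delta>"]) auto
qed

section \<open>Hoelder functions\<close>

text \<open>The difference quotient is dominated by the second supremum, and the first one is
  nonnegative. Finiteness is what makes \<open>enn2real\<close> return the true value of the norm
  instead of its default 0.\<close>

lemma abs_diff_le_holder_norm: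
  fixes u :: "'a::euclidean_space \<Rightarrow> real"
  assumes "holder_enorm \<alpha> u < \<infinity>"
  shows "\<bar>u x - u y\<bar> \<le> holder_norm \<alpha> u * norm (x - y) powr \<alpha>"
proof (cases "x = y")
  case False
  have "ennreal (\<bar>u x - u y\<bar> / norm (x - y) powr \<alpha>)
      \<le> (SUP (x, y)\<in>{(x, y). x \<noteq> y}. ennreal (\<bar>u x - u y\<bar> / norm (x - y) powr \<alpha>))"
    using False by (intro SUP_upper2[of "(x, y)"]) auto
  also have "\<dots> \<le> holder_enorm \<alpha> u"
    unfolding holder_enorm_def by (simp add: add_increasing)
  also have "\<dots> = ennreal (holder_norm \<alpha> u)"
    using assms by (simp add: holder_norm_def)
  finally have "\<bar>u x - u y\<bar> / norm (x - y) powr \<alpha> \<le> holder_norm \<alpha> u"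
    by (simp add: holder_norm_def)
  then show ?thesis using False by (simp add: field_simps)
qed simp

text \<open>Supplies the measurability of the collision integrand in \<sigma>.\<close>

lemma continuous_on_holder:
  fixes u :: "'a::euclidean_space \<Rightarrow> real"
  assumes "holder_enorm \<alpha> u < \<infinity>" "0 < \<alpha>"
  shows "continuous_on UNIV u"
proof -
  have "(u \<longlongrightarrow> u x) (at x)" for x
  proof -
    have "((\<lambda>y. norm (y - x)) \<longlongrightarrow> 0) (at x)"
      by (rule tendsto_norm_zero[OF LIM_zero[OF tendsto_ident_at]])
    then have "((\<lambda>y. norm (y - x) powr \<alpha>) \<longlongrightarrow> 0) (at x)"
      using assms(2) by (intro tendsto_zero_powrI[OF _ tendsto_const]) auto
    then have "((\<lambda>y. holder_norm \<alpha> u * norm (y - x) powr \<alpha>) \<longlongrightarrow> 0) (at x)"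
      by (rule tendsto_mult_right_zero)
    then have "((\<lambda>y. u y - u x) \<longlongrightarrow> 0) (at x)"
      by (rule Lim_null_comparison[rotated])
        (simp add: abs_diff_le_holder_norm[OF assms(1)])
    then show ?thesis by (rule LIM_zero_cancel)
  qed
  then show ?thesis by (simp add: continuous_on_def)
qed

section \<open>Exponents and moments of the angular kernel\<close>

text \<open>Eliminating a finite \<open>s\<close> gives \<gamma> = 1 - 2 \<nu>, so
  \<open>\<gamma> \<le> 1\<close> settles the sign. For infinite \<open>s\<close> the quotient 2 /
  (s - 1) is 0.\<close>

lemma exponent_nonneg:
  fixes s :: ereal
  assumes "ereal \<gamma> = 1 - 4 / (s - 1)" "ereal \<nu> = 2 / (s - 1)" "\<gamma> \<le> 1"
  shows "0 \<le> \<nu>"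
proof (cases "s - 1")
  case (real r)
  \<comment> \<open>In the extended reals 2 / 0 is infinite, whereas \<nu> is real.\<close>
  then have "r \<noteq> 0" using assms(2) by (auto simp: zero_ereal_def[symmetric])
  then have "\<gamma> = 1 - 4 / r" "\<nu> = 2 / r"
    using assms real by (simp_all add: one_ereal_def numeral_eq_ereal)
  then have "\<gamma> = 1 - 2 * \<nu>" by simp
  then show ?thesis using assms(3) by simp
next
  case PInf then show ?thesis using assms(2) by simp
next
  case MInf then show ?thesis using assms(2) by simp
qed

lemma integrable_singular_zonal:
  fixes b :: "real \<Rightarrow> real"
  assumes b_meas: "b \<in> borel_measurable (restrict_space borel {-1..1})"
    and b_nonneg: "\<forall>t\<in>{-1..1}. 0 \<le> b t"
    and sing: "(\<lambda>\<theta>. sin \<theta> * b (cos \<theta>)) \<sim>[at_right 0] (\<lambda>\<theta>. K * \<theta> powr (- 1 - \<nu>))"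
    and K: "0 < K" and \<nu>: "0 \<le> \<nu>" "\<nu> < \<alpha>" "\<alpha> < 1"
    and mom: "integrable sphere_measure (\<lambda>\<sigma>. b (axis 1 1 \<bullet> \<sigma>) * (1 - axis 1 1 \<bullet> \<sigma>))"
  shows "integrable sphere_measure
    (\<lambda>\<sigma>. b (axis 1 1 \<bullet> \<sigma>) * ((1 - axis 1 1 \<bullet> \<sigma>) / 2) powr (\<alpha> / 2))"
proof -
  obtain c where c: "0 < c" "c \<le> 1"
    and b: "\<And>t. 1 - c < t \<Longrightarrow> t < 1 \<Longrightarrow> 0 < b t \<and> b t \<le> 2 * K * (1 - t) powr (- 1 - \<nu> / 2)"
    using kernel_bounds_near_one[OF sing K \<nu>(1)] by metis
  \<comment> \<open>\<open>-p\<close> is the sum of the exponent -1 - \<nu>/2 of the kernel bound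
    and the gain \<alpha>/2 from the Hoelder condition; \<open>\<nu> < \<alpha>\<close> is precisely
    \<open>p < 1\<close>.\<close>
  define p where "p = 1 - (\<alpha> - \<nu>) / 2"
  have p: "0 < p" "p < 1" using \<nu> by (auto simp: p_def)
  \<comment> \<open>The first summand dominates for 1 - t \<ge> c, where 1 \<le> (1 - t) / c, and
    the second for 0 < 1 - t < c. At 1 - t = 0 the weight vanishes because
    \<open>0 powr a = 0\<close>, whatever the value of \<open>b 1\<close>.\<close>
  define F where "F t = (1 / c) * (b t * (1 - t)) +
    2 * K * ((1 - t) powr (-p) * indicator {0<..1} (1 - t))" for t
  have bound: "\<bar>b t * ((1 - t) / 2) powr (\<alpha> / 2)\<bar> \<le> F t" if t: "t \<in> {-1..1}" for t
  proof -
    define y where "y = 1 - t"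
    have y: "0 \<le> y" "y \<le> 2" using t by (auto simp: y_def)
    have bt: "0 \<le> b t" using t b_nonneg by blast
    have nonneg: "0 \<le> (1 / c) * (b t * y)" "0 \<le> 2 * K * (y powr (-p) * indicator {0<..1} y)"
      using bt y c K by auto
    have "b t * (y / 2) powr (\<alpha> / 2) \<le> F t"
    proof -
      consider "y = 0" | "0 < y" "y < c" | "c \<le> y" using y by linarith
      then show ?thesis
      proof cases
        case 1
        then show ?thesis using nonneg by (simp add: F_def y_def)
      next
        case 2
        have "b t * (y / 2) powr (\<alpha> / 2) \<le> (2 * K * y powr (- 1 - \<nu> / 2)) * y powr (\<alpha> / 2)"
          using 2 b[of t] K \<nu> by (intro mult_mono powr_mono2) (auto simp: y_def)
        also have "\<dots> = 2 * K * (y powr (-p) * indicator {0<..1} y)"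
        proof -
          have "- 1 - \<nu> / 2 + \<alpha> / 2 = -p" by (simp add: p_def field_simps)
          then show ?thesis using 2 c by (simp add: powr_add[symmetric])
        qed
        finally show ?thesis using nonneg by (simp add: F_def y_def)
      next
        case 3
        have "(y / 2) powr (\<alpha> / 2) \<le> 1" using y \<nu> by (intro powr_le1) auto
        moreover have "1 \<le> y / c" using 3 c by simp
        ultimately have "b t * (y / 2) powr (\<alpha> / 2) \<le> b t * (y / c)"
          using bt by (intro mult_left_mono) auto
        then show ?thesis using nonneg by (simp add: F_def y_def)
      qed
    qed
    then show ?thesis using bt by (simp add: y_def)
  qed
  have n1: "norm (axis 1 1 :: real^3) = 1" by simp
  have "integrable sphere_measure (\<lambda>\<sigma>. F (axis 1 1 \<bullet> \<sigma>))"
    unfolding F_def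
    by (intro Bochner_Integration.integrable_add integrable_mult_right mom integrable_cap_powr p)
  moreover have "(\<lambda>\<sigma>. b (axis 1 1 \<bullet> \<sigma>) * ((1 - axis 1 1 \<bullet> \<sigma>) / 2) powr (\<alpha> / 2))
      \<in> borel_measurable sphere_measure"
  proof -
    have "(\<lambda>\<sigma>. b (axis 1 1 \<bullet> \<sigma>)) \<in> borel_measurable sphere_measure"
      using measurable_inner_sphere_measure[OF n1] b_meas by (rule measurable_compose)
    moreover have "(\<lambda>\<sigma>::real^3. ((1 - axis 1 1 \<bullet> \<sigma>) / 2) powr (\<alpha> / 2)) \<in> borel_measurable sphere_measure"
      by (rule borel_measurable_sphere_measureI) measurable
    ultimately show ?thesis by (rule borel_measurable_times)
  qed
  ultimately show ?thesis
  proof (rule Bochner_Integration.integrable_bound)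
    show "AE \<sigma> in sphere_measure. norm (b (axis 1 1 \<bullet> \<sigma>) * ((1 - axis 1 1 \<bullet> \<sigma>) / 2) powr (\<alpha> / 2))
        \<le> norm (F (axis 1 1 \<bullet> \<sigma>))"
    proof (rule AE_I2)
      fix \<sigma> :: "real^3" assume "\<sigma> \<in> space sphere_measure"
      then have "axis 1 1 \<bullet> \<sigma> \<in> {-1..1}" using inner_unit_bounds[OF n1, of \<sigma>] by simp
      from bound[OF this]
      show "norm (b (axis 1 1 \<bullet> \<sigma>) * ((1 - axis 1 1 \<bullet> \<sigma>) / 2) powr (\<alpha> / 2)) \<le> norm (F (axis 1 1 \<bullet> \<sigma>))"
        by simp
    qed
  qed
qed

text \<open>A nonnegative integrand with zero integral vanishes almost everywhere, but this one is
  positive on a spherical segment of positive measure. The positivity permits division by this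
  moment when the second inequality is derived.\<close>

lemma zonal_moment_pos:
  fixes b :: "real \<Rightarrow> real"
  assumes b_nonneg: "\<forall>t\<in>{-1..1}. 0 \<le> b t"
    and c: "0 < c" "c \<le> 1" and pos: "\<And>t. 1 - c < t \<Longrightarrow> t < 1 \<Longrightarrow> 0 < b t"
    and int: "integrable sphere_measure (\<lambda>\<sigma>. b (axis 1 1 \<bullet> \<sigma>) * (1 - axis 1 1 \<bullet> \<sigma>))"
  shows "0 < (LINT \<sigma>|sphere_measure. b (axis 1 1 \<bullet> \<sigma>) * (1 - axis 1 1 \<bullet> \<sigma>))"
proof -
  let ?f = "\<lambda>\<sigma>::real^3. b (axis 1 1 \<bullet> \<sigma>) * (1 - axis 1 1 \<bullet> \<sigma>)"
  let ?S = "{\<sigma> \<in> space sphere_measure. 1 - c < axis 1 1 \<bullet> \<sigma> \<and> axis 1 1 \<bullet> \<sigma> < 1}"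
  have nonneg: "AE \<sigma> in sphere_measure. 0 \<le> ?f \<sigma>"
  proof (rule AE_I2)
    fix \<sigma> :: "real^3" assume "\<sigma> \<in> space sphere_measure"
    then have "axis 1 1 \<bullet> \<sigma> \<in> {-1..1}"
      using inner_unit_bounds[of "axis 1 1" \<sigma>] by simp
    then show "0 \<le> ?f \<sigma>" using b_nonneg by auto
  qed
  have "(LINT \<sigma>|sphere_measure. ?f \<sigma>) \<noteq> 0"
  proof
    assume "(LINT \<sigma>|sphere_measure. ?f \<sigma>) = 0"
    then have "AE \<sigma> in sphere_measure. ?f \<sigma> = 0"
      using integral_nonneg_eq_0_iff_AE[OF int nonneg] by simp
    then have "AE \<sigma> in sphere_measure. \<not> (1 - c < axis 1 1 \<bullet> \<sigma> \<and> axis 1 1 \<bullet> \<sigma> < 1)"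
      by (rule eventually_mono) (use pos in force)
    moreover have "{\<sigma> \<in> space sphere_measure. \<not> \<not> (1 - c < axis 1 1 \<bullet> \<sigma> \<and> axis 1 1 \<bullet> \<sigma> < 1)}
        \<in> sets sphere_measure"
    proof -
      have [measurable]: "(\<lambda>\<sigma>::real^3. axis 1 1 \<bullet> \<sigma>) \<in> borel_measurable sphere_measure"
        by (rule borel_measurable_sphere_measureI) measurable
      show ?thesis by measurable
    qed
    ultimately have "emeasure sphere_measure ?S = 0"
      by (subst (asm) AE_iff_measurable[OF _ refl]) auto
    then show False using emeasure_spherical_segment_nonzero[OF c] by contradiction
  qed
  moreover have "0 \<le> (LINT \<sigma>|sphere_measure. ?f \<sigma>)"
    using nonneg by (rule integral_nonneg_AE)
  ultimately show ?thesis by linarith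
qed

section \<open>Geometry of a collision and the pointwise estimate\<close>

text \<open>With r and k the length and direction of v - v_*, one has v' - v = (r/2)(\<sigma> - k)
  and |\<sigma> - k|^2 = 2 - 2 k \<bullet> \<sigma>. The right side is r sin(\<theta>/2).\<close>

lemma norm_post_velocity_diff:
  assumes "v \<noteq> vs" "norm \<sigma> = 1"
  shows "norm (post_velocity v vs \<sigma> - v) =
    norm (v - vs) * sqrt ((1 - ((v - vs) /\<^sub>R norm (v - vs)) \<bullet> \<sigma>) / 2)"
proof -
  define r where "r = norm (v - vs)"
  define k where "k = (v - vs) /\<^sub>R r"
  have r: "0 < r" using assms by (simp add: r_def)
  have k: "norm k = 1" "v - vs = r *\<^sub>R k" using r by (auto simp: k_def r_def)
  have half: "(v + vs) /\<^sub>R 2 - v = - ((v - vs) /\<^sub>R 2)"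
    by (simp add: vec_eq_iff field_simps)
  have "post_velocity v vs \<sigma> - v = (r / 2) *\<^sub>R \<sigma> + ((v + vs) /\<^sub>R 2 - v)"
    by (simp add: post_velocity_def r_def)
  also have "\<dots> = (r / 2) *\<^sub>R (\<sigma> - k)"
    unfolding half k(2) by (simp add: algebra_simps)
  finally have "norm (post_velocity v vs \<sigma> - v) = r * (norm (\<sigma> - k) / 2)"
    using r by simp
  also have "norm (\<sigma> - k) / 2 = sqrt ((1 - k \<bullet> \<sigma>) / 2)"
  proof -
    have "(norm (\<sigma> - k))\<^sup>2 = 2 - 2 * (k \<bullet> \<sigma>)"
      using assms(2) k(1)
      by (simp add: power2_norm_eq_inner inner_diff_left inner_diff_right inner_commute norm_eq_1)
    then have "(norm (\<sigma> - k) / 2)\<^sup>2 = (1 - k \<bullet> \<sigma>) / 2"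
      by (simp add: power_divide field_simps)
    then show ?thesis by (metis norm_ge_zero divide_nonneg_pos real_sqrt_unique zero_less_numeral)
  qed
  finally show ?thesis by (simp add: k_def r_def)
qed

text \<open>The kernel contributes r^\<gamma> and the Hoelder condition contributes r^\<alpha>; the
  square root in |v' - v| halves the exponent of the angular factor.\<close>

lemma collision_integrand_le:
  assumes ne: "v \<noteq> vs" and \<sigma>: "norm \<sigma> = 1"
    and fin: "holder_enorm \<alpha> \<phi> < \<infinity>" and b_nonneg: "\<forall>t\<in>{-1..1}. 0 \<le> b t"
  shows "\<bar>collision_kernel \<gamma> b (v - vs) \<sigma> * (\<phi> (post_velocity v vs \<sigma>) - \<phi> v)\<bar>
    \<le> holder_norm \<alpha> \<phi> * norm (v - vs) powr (\<alpha> + \<gamma>) *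
       (b (((v - vs) /\<^sub>R norm (v - vs)) \<bullet> \<sigma>) *
        ((1 - ((v - vs) /\<^sub>R norm (v - vs)) \<bullet> \<sigma>) / 2) powr (\<alpha> / 2))"
proof -
  define r where "r = norm (v - vs)"
  define t where "t = ((v - vs) /\<^sub>R norm (v - vs)) \<bullet> \<sigma>"
  have r: "0 < r" using ne by (simp add: r_def)
  have t: "t \<in> {-1..1}" unfolding t_def using ne \<sigma> by (intro inner_unit_bounds) auto
  then have bt: "0 \<le> b t" using b_nonneg by blast
  have "\<bar>\<phi> (post_velocity v vs \<sigma>) - \<phi> v\<bar> \<le> holder_norm \<alpha> \<phi> * (r * sqrt ((1 - t) / 2)) powr \<alpha>"
    using abs_diff_le_holder_norm[OF fin, of "post_velocity v vs \<sigma>" v]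
    by (simp add: norm_post_velocity_diff[OF ne \<sigma>] r_def t_def)
  also have "(r * sqrt ((1 - t) / 2)) powr \<alpha> = r powr \<alpha> * ((1 - t) / 2) powr (\<alpha> / 2)"
    using r t by (simp add: powr_mult powr_half_sqrt[symmetric] powr_powr)
  finally have "(r powr \<gamma> * b t) * \<bar>\<phi> (post_velocity v vs \<sigma>) - \<phi> v\<bar>
      \<le> (r powr \<gamma> * b t) * (holder_norm \<alpha> \<phi> * (r powr \<alpha> * ((1 - t) / 2) powr (\<alpha> / 2)))"
    using bt by (intro mult_left_mono) auto
  then show ?thesis
    using bt by (simp add: collision_kernel_def abs_mult r_def t_def powr_add mult_ac)
qed

section \<open>Uniform bounds for the collision transform\<close>

theorem lemma4p3:
  fixes s :: ereal and \<gamma> \<nu> \<alpha> K :: real and b :: "real \<Rightarrow> real"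
  assumes gamma_s: "ereal \<gamma> = 1 - 4 / (s - 1)"
    and nu_s: "ereal \<nu> = 2 / (s - 1)"
    and b_meas: "b \<in> borel_measurable (restrict_space borel {-1..1})"
    and b_nonneg: "\<forall>t\<in>{-1..1}. 0 \<le> b t"
    and b_supp: "\<forall>\<theta>\<in>{pi/2<..pi}. b (cos \<theta>) = 0"
    and K_pos: "0 < K"
    and b_sing: "(\<lambda>\<theta>. sin \<theta> * b (cos \<theta>)) \<sim>[at_right 0] (\<lambda>\<theta>. K * \<theta> powr (- 1 - \<nu>))"
    and M_finite: "\<forall>z. z \<noteq> 0 \<longrightarrow> integrable sphere_measure
           (\<lambda>\<sigma>. collision_kernel \<gamma> b z \<sigma> * (1 - (z /\<^sub>R norm z) \<bullet> \<sigma>))"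
    and gamma_range: "- 3 < \<gamma>" "\<gamma> \<le> 1"
    and alpha_range: "\<nu> < \<alpha>" "\<alpha> < 1"
  shows "\<exists>C>0. \<exists>C'>0. \<forall>vs. \<forall>\<phi>\<in>holder_c \<alpha>. \<forall>v.
           integrable sphere_measure
             (\<lambda>\<sigma>. collision_kernel \<gamma> b (v - vs) \<sigma> * (\<phi> (post_velocity v vs \<sigma>) - \<phi> v)) \<and>
           \<bar>collision_transform \<gamma> b vs \<phi> v\<bar>
             \<le> C * holder_norm \<alpha> \<phi> * norm (v - vs) powr (\<alpha> + \<gamma>) \<and>
           C * holder_norm \<alpha> \<phi> * norm (v - vs) powr (\<alpha> + \<gamma>)
             \<le> C' * holder_norm \<alpha> \<phi> * norm (v - vs) powr \<alpha> *
                 momentum_transfer \<gamma> b (norm (v - vs))"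
proof -
  have \<nu>: "0 \<le> \<nu>" by (rule exponent_nonneg[OF gamma_s nu_s gamma_range(2)])
  have \<alpha>: "0 < \<alpha>" using \<nu> alpha_range by linarith
  have n1: "norm (axis 1 1 :: real^3) = 1" by simp
  then have "axis 1 1 \<noteq> (0 :: real^3)" by force
  \<comment> \<open>At a unit vector the factor r^\<gamma> is 1, so the finite momentum transfer is
    a statement about \<open>b\<close> alone.\<close>
  then have mom: "integrable sphere_measure (\<lambda>\<sigma>. b (axis 1 1 \<bullet> \<sigma>) * (1 - axis 1 1 \<bullet> \<sigma>))"
    using M_finite[rule_format, of "axis 1 1"] by (simp add: collision_kernel_def)
  define g where "g t = b t * ((1 - t) / 2) powr (\<alpha> / 2)" for t
  have g_meas: "g \<in> borel_measurable (restrict_space borel {-1..1})"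
  proof -
    have "(\<lambda>t::real. ((1 - t) / 2) powr (\<alpha> / 2)) \<in> borel_measurable (restrict_space borel {-1..1})"
      by (rule measurable_restrict_space1) measurable
    with b_meas show ?thesis unfolding g_def by (rule borel_measurable_times)
  qed
  have g_int: "integrable sphere_measure (\<lambda>\<sigma>. g (axis 1 1 \<bullet> \<sigma>))"
    unfolding g_def
    by (rule integrable_singular_zonal[OF b_meas b_nonneg b_sing K_pos \<nu> alpha_range mom])
  define I where "I = (LINT \<sigma>|sphere_measure. g (axis 1 1 \<bullet> \<sigma>))"
  define m where "m = (LINT \<sigma>|sphere_measure. b (axis 1 1 \<bullet> \<sigma>) * (1 - axis 1 1 \<bullet> \<sigma>))"
  obtain c where c: "0 < c" "c \<le> 1"
    and "\<And>t. 1 - c < t \<Longrightarrow> t < 1 \<Longrightarrow> 0 < b t \<and> b t \<le> 2 * K * (1 - t) powr (- 1 - \<nu> / 2)"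
    using kernel_bounds_near_one[OF b_sing K_pos \<nu>] by metis
  then have m: "0 < m"
    unfolding m_def by (intro zonal_moment_pos[OF b_nonneg c _ mom]) blast
  have I: "0 \<le> I"
    unfolding I_def
  proof (rule integral_nonneg_AE, rule AE_I2)
    fix \<sigma> :: "real^3" assume "\<sigma> \<in> space sphere_measure"
    then have "axis 1 1 \<bullet> \<sigma> \<in> {-1..1}" using inner_unit_bounds[OF n1, of \<sigma>] by simp
    then show "0 \<le> g (axis 1 1 \<bullet> \<sigma>)" using b_nonneg by (auto simp: g_def)
  qed
  have bound: "integrable sphere_measure
      (\<lambda>\<sigma>. collision_kernel \<gamma> b (v - vs) \<sigma> * (\<phi> (post_velocity v vs \<sigma>) - \<phi> v)) \<and>
      \<bar>collision_transform \<gamma> b vs \<phi> v\<bar> \<le> I * holder_norm \<alpha> \<phi> * norm (v - vs) powr (\<alpha> + \<gamma>)"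
    if "\<phi> \<in> holder_c \<alpha>" for vs \<phi> v
  proof (cases "v = vs")
    case True
    \<comment> \<open>At zero relative velocity \<open>0 powr \<gamma> = 0\<close> makes the kernel,
      and hence the transform, vanish; the bound is 0 as well.\<close>
    then show ?thesis by (simp add: collision_kernel_def collision_transform_def)
  next
    case False
    have fin: "holder_enorm \<alpha> \<phi> < \<infinity>" using that by (simp add: holder_c_def)
    define k where "k = (v - vs) /\<^sub>R norm (v - vs)"
    define A where "A = holder_norm \<alpha> \<phi> * norm (v - vs) powr (\<alpha> + \<gamma>)"
    let ?f = "\<lambda>\<sigma>. collision_kernel \<gamma> b (v - vs) \<sigma> * (\<phi> (post_velocity v vs \<sigma>) - \<phi> v)"
    have nk: "norm k = 1" using False by (simp add: k_def)
    have dom: "integrable sphere_measure (\<lambda>\<sigma>. A * g (k \<bullet> \<sigma>))"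
      using sphere_measure_zonal_eq(1)[OF g_meas n1 nk] g_int by simp
    have le: "AE \<sigma> in sphere_measure. norm (?f \<sigma>) \<le> A * g (k \<bullet> \<sigma>)"
    proof (rule AE_I2)
      fix \<sigma> :: "real^3" assume "\<sigma> \<in> space sphere_measure"
      then show "norm (?f \<sigma>) \<le> A * g (k \<bullet> \<sigma>)"
        using collision_integrand_le[OF False _ fin b_nonneg, of \<sigma> \<gamma>]
        by (simp add: A_def g_def k_def)
    qed
    have meas: "?f \<in> borel_measurable sphere_measure"
    proof -
      have "(\<lambda>\<sigma>. b (k \<bullet> \<sigma>)) \<in> borel_measurable sphere_measure"
        using measurable_inner_sphere_measure[OF nk] b_meas by (rule measurable_compose)
      then have "(\<lambda>\<sigma>. collision_kernel \<gamma> b (v - vs) \<sigma>) \<in> borel_measurable sphere_measure"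
        unfolding collision_kernel_def k_def by (rule borel_measurable_times[OF borel_measurable_const])
      moreover have "(\<lambda>\<sigma>. \<phi> (post_velocity v vs \<sigma>) - \<phi> v) \<in> borel_measurable sphere_measure"
      proof (intro borel_measurable_sphere_measureI borel_measurable_continuous_onI)
        show "continuous_on UNIV (\<lambda>\<sigma>. \<phi> (post_velocity v vs \<sigma>) - \<phi> v)"
          unfolding post_velocity_def
          by (intro continuous_intros continuous_on_compose2[OF continuous_on_holder[OF fin \<alpha>]]) auto
      qed
      ultimately show ?thesis by (rule borel_measurable_times)
    qed
    have int: "integrable sphere_measure ?f"
      by (rule Bochner_Integration.integrable_bound[OF dom meas]) (use le in force)
    have "\<bar>collision_transform \<gamma> b vs \<phi> v\<bar> \<le> (LINT \<sigma>|sphere_measure. A * g (k \<bullet> \<sigma>))"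
      unfolding collision_transform_def real_norm_def[symmetric]
      by (rule Bochner_Integration.integral_norm_bound[THEN order_trans])
        (intro integral_mono_AE integrable_norm int dom le)
    also have "\<dots> = I * A"
      by (simp add: I_def sphere_measure_zonal_eq(2)[OF g_meas n1 nk])
    finally show ?thesis using int by (simp add: A_def mult.assoc)
  qed
  \<comment> \<open>The factor r^\<gamma> comes out of the integral, so M(r) = m r^\<gamma>. At r =
    0 both sides are 0 by the convention for \<open>powr\<close>.\<close>
  have momentum: "norm (v - vs) powr (\<alpha> + \<gamma>) * m =
      norm (v - vs) powr \<alpha> * momentum_transfer \<gamma> b (norm (v - vs))" for v vs :: "real^3"
    by (cases "v = vs")
      (simp_all add: momentum_transfer_def collision_kernel_def m_def powr_add mult.assoc)
  \<comment> \<open>The integral \<open>I\<close> is only known to be nonnegative, so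
    \<open>I + 1\<close> is taken to have a strictly positive constant. Dividing it by
    \<open>m\<close> turns the second inequality into an equality.\<close>
  show ?thesis
  proof (rule exI[of _ "I + 1"], intro conjI exI[of _ "(I + 1) / m"] allI ballI)
    fix vs v :: "real^3" and \<phi> :: "real^3 \<Rightarrow> real" assume \<phi>: "\<phi> \<in> holder_c \<alpha>"
    let ?A = "holder_norm \<alpha> \<phi> * norm (v - vs) powr (\<alpha> + \<gamma>)"
    show "integrable sphere_measure
        (\<lambda>\<sigma>. collision_kernel \<gamma> b (v - vs) \<sigma> * (\<phi> (post_velocity v vs \<sigma>) - \<phi> v))"
      using bound[OF \<phi>] by blast
    have "I * ?A \<le> (I + 1) * ?A"
      by (intro mult_right_mono) (auto simp: holder_norm_def)
    then show "\<bar>collision_transform \<gamma> b vs \<phi> v\<bar>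
        \<le> (I + 1) * holder_norm \<alpha> \<phi> * norm (v - vs) powr (\<alpha> + \<gamma>)"
      using bound[OF \<phi>, of v vs] by (simp add: mult.assoc)
    have "norm (v - vs) powr (\<alpha> + \<gamma>) =
        norm (v - vs) powr \<alpha> * momentum_transfer \<gamma> b (norm (v - vs)) / m"
      using momentum[of v vs] m by (simp add: eq_divide_eq)
    then show "(I + 1) * holder_norm \<alpha> \<phi> * norm (v - vs) powr (\<alpha> + \<gamma>)
        \<le> (I + 1) / m * holder_norm \<alpha> \<phi> * norm (v - vs) powr \<alpha> *
          momentum_transfer \<gamma> b (norm (v - vs))"
      by simp
  qed (use I m in auto)
qed

end
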